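(* In XCCS-PDL the rule (PCSub) is sound: if $\Vdash \langle P\rangle p\leftrightarrow\langle Q\rangle p$, then $\Vdash\langle P|R\rangle p\leftrightarrow\langle Q|R\rangle p$.
   Context: XCCS-PDL formulas: $\varphi ::= p\mid\top\mid\neg\varphi\mid\varphi_1\land\varphi_2\mid\langle\alpha\rangle\varphi\mid\langle P\rangle\varphi$, with XCCS processes $P ::= {\bf 0}\mid END\mid\alpha.P\mid P_1;P_2\mid P_1+P_2\mid P_1|P_2\mid P^*\mid P\backslash L$ (running actions $\alpha ::= a\mid\overline a\mid\tau$; successful termination $\mathrm{Done}$ only via the ending action $END$). $\overrightarrow{{\cal R}_f}(P)=\{\overrightarrow{\alpha}:P\stackrel{\overrightarrow{\alpha}}{\Rightarrow}\mathrm{Done}\}$ under the XCCS transition rules. Frames $(W,\{R_\alpha\},R_{END})$ with $R_{END}$ the identity on $W$; ${\cal M},w\Vdash\langle P\rangle\varphi$ iff there is a path $(v_0,\ldots,v_n)$, $n\ge1$, $v_0=w$, ${\cal M},v_n\Vdash\varphi$, and $\overrightarrow{\alpha}\in\overrightarrow{{\cal R}_f}(P)$ of length $n$ with $(v_{i-1},v_i)\in R_\beta$ iff $(\overrightarrow{\alpha})_i=\beta$. $\Vdash$ = validity over all models. Known facts: $\overrightarrow{{\cal R}_f}(P)=\overrightarrow{{\cal R}_f}(Q)$ iff $\Vdash\langle P\rangle p\leftrightarrow\langle Q\rangle p$; and $\overrightarrow{{\cal R}_f}(P_1|P_2)=\bigcup\{\overrightarrow{{\cal R}_f}(\overrightarrow{\alpha}|\overrightarrow{\beta}):\overrightarrow{\alpha}\in\overrightarrow{{\cal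 R}_f}(P_1),\overrightarrow{\beta}\in\overrightarrow{{\cal R}_f}(P_2)\}$. *)

theory Defs
  imports Main "HOL-Library.Countable_Set"
begin

datatype 'n label = Name 'n | Coname 'n

fun co :: "'n label \<Rightarrow> 'n label" where
  "co (Name a) = Coname a"
| "co (Coname a) = Name a"

datatype 'n running = Lab "'n label" | Tau

datatype 'n action = Run "'n running" | End

datatype 'n proc =
    Zero                                       (\<open>\<zero>\<close>)
  | END
  | Prefix "'n running" "'n proc"              (infixr \<open>\<cdot>\<close> 85)
  | Seq "'n proc" "'n proc"                    (infixr \<open>;;\<close> 75)
  | Choice "'n proc" "'n proc"                 (infixr \<open>\<oplus>\<close> 70)
  | Par "'n proc" "'n proc"                    (infixr \<open>\<parallel>\<close> 72)
  | Iter "'n proc"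
  | Restrict "'n proc" "'n label set"

text \<open>Done is a state reached by transitions, but not itself a process term.\<close>

datatype 'n state = Proc "'n proc" | Done

text \<open>
  The action \<open>End\<close> is the only one leading to \<open>Done\<close>. In a sequential composition the
  \<open>End\<close> of the first component is absorbed by the first transition of the second one; a parallel
  composition ends when both components end. Hence \<open>End\<close> occurs exactly once, at the very end,
  in each successful run, so that such a run is itself a process
  \<open>\<alpha>\<^sub>1. \<dots> .\<alpha>\<^sub>k.END\<close>.
\<close>

inductive step :: "'n proc \<Rightarrow> 'n action \<Rightarrow> 'n state \<Rightarrow> bool" where
  step_END: "step END End Done"
| step_Prefix: "step (\<alpha> \<cdot> P) (Run \<alpha>) (Proc P)"
| step_Seq_run: "step P (Run \<alpha>) (Proc P') \<Longrightarrow> step (P ;; Q) (Run \<alpha>) (Proc (P' ;; Q))"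
| step_Seq_end: "step P End Done \<Longrightarrow> step Q \<gamma> X \<Longrightarrow> step (P ;; Q) \<gamma> X"
| step_ChoiceL: "step P \<gamma> X \<Longrightarrow> step (P \<oplus> Q) \<gamma> X"
| step_ChoiceR: "step Q \<gamma> X \<Longrightarrow> step (P \<oplus> Q) \<gamma> X"
| step_ParL: "step P (Run \<alpha>) (Proc P') \<Longrightarrow> step (P \<parallel> Q) (Run \<alpha>) (Proc (P' \<parallel> Q))"
| step_ParR: "step Q (Run \<alpha>) (Proc Q') \<Longrightarrow> step (P \<parallel> Q) (Run \<alpha>) (Proc (P \<parallel> Q'))"
| step_Par_sync: "step P (Run (Lab l)) (Proc P') \<Longrightarrow> step Q (Run (Lab (co l))) (Proc Q')
    \<Longrightarrow> step (P \<parallel> Q) (Run Tau) (Proc (P' \<parallel> Q'))"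
| step_Par_end: "step P End Done \<Longrightarrow> step Q End Done \<Longrightarrow> step (P \<parallel> Q) End Done"
| step_Iter_end: "step (Iter P) End Done"
| step_Iter_run: "step P (Run \<alpha>) (Proc P') \<Longrightarrow> step (Iter P) (Run \<alpha>) (Proc (P' ;; Iter P))"
| step_Restrict_tau: "step P (Run Tau) (Proc P')
    \<Longrightarrow> step (Restrict P L) (Run Tau) (Proc (Restrict P' L))"
| step_Restrict_lab: "step P (Run (Lab l)) (Proc P') \<Longrightarrow> l \<notin> L \<Longrightarrow> co l \<notin> L
    \<Longrightarrow> step (Restrict P L) (Run (Lab l)) (Proc (Restrict P' L))"
| step_Restrict_end: "step P End Done \<Longrightarrow> step (Restrict P L) End Done"

inductive steps :: "'n state \<Rightarrow> 'n action list \<Rightarrow> 'n state \<Rightarrow> bool" where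
  steps_Nil: "steps X [] X"
| steps_Cons: "step P \<gamma> X \<Longrightarrow> steps X \<gamma>s Y \<Longrightarrow> steps (Proc P) (\<gamma> # \<gamma>s) Y"

definition Rf :: "'n proc \<Rightarrow> 'n action list set" where
  "Rf P = {\<gamma>s. steps (Proc P) \<gamma>s Done}"

datatype ('n, 'p) fm =
    Atom 'p
  | Top
  | Neg "('n, 'p) fm"
  | Conj "('n, 'p) fm" "('n, 'p) fm"
  | DiaA "'n running" "('n, 'p) fm"
  | DiaP "'n proc" "('n, 'p) fm"

definition Iff :: "('n, 'p) fm \<Rightarrow> ('n, 'p) fm \<Rightarrow> ('n, 'p) fm" where
  "Iff \<phi> \<psi> = Conj (Neg (Conj \<phi> (Neg \<psi>))) (Neg (Conj \<psi> (Neg \<phi>)))"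

record ('w, 'n, 'p) model =
  worlds :: "'w set"
  rel_run :: "'n running \<Rightarrow> ('w \<times> 'w) set"
  rel_end :: "('w \<times> 'w) set"
  val :: "'p \<Rightarrow> 'w set"

definition is_model :: "('w, 'n, 'p) model \<Rightarrow> bool" where
  "is_model M \<longleftrightarrow> worlds M \<noteq> {} \<and> (\<forall>\<alpha>. rel_run M \<alpha> \<subseteq> worlds M \<times> worlds M) \<and>
     rel_end M = Id_on (worlds M) \<and> (\<forall>p. val M p \<subseteq> worlds M)"

fun rel :: "('w, 'n, 'p) model \<Rightarrow> 'n action \<Rightarrow> ('w \<times> 'w) set" where
  "rel M (Run \<alpha>) = rel_run M \<alpha>"
| "rel M End = rel_end M"

text \<open>
  The path \<open>(v\<^sub>0, \<dots>, v\<^sub>n)\<close> is the restriction of \<open>v\<close> to \<open>{..n}\<close>. List positions start at 0,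
  so \<open>\<gamma>s ! i\<close> labels the edge from \<open>v i\<close> to \<open>v (Suc i)\<close>.
\<close>

primrec sat :: "('w, 'n, 'p) model \<Rightarrow> 'w \<Rightarrow> ('n, 'p) fm \<Rightarrow> bool" where
  "sat M w (Atom p) \<longleftrightarrow> w \<in> val M p"
| "sat M w Top \<longleftrightarrow> True"
| "sat M w (Neg \<phi>) \<longleftrightarrow> \<not> sat M w \<phi>"
| "sat M w (Conj \<phi> \<psi>) \<longleftrightarrow> sat M w \<phi> \<and> sat M w \<psi>"
| "sat M w (DiaA \<alpha> \<phi>) \<longleftrightarrow> (\<exists>v. (w, v) \<in> rel_run M \<alpha> \<and> sat M v \<phi>)"
| "sat M w (DiaP P \<phi>) \<longleftrightarrow>
     (\<exists>v n \<gamma>s. n \<ge> 1 \<and> (\<forall>i\<le>n. v i \<in> worlds M) \<and> v 0 = w \<and> sat M (v n) \<phi> \<and>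
        \<gamma>s \<in> Rf P \<and> length \<gamma>s = n \<and>
        (\<forall>i<n. \<forall>\<beta>. (v i, v (Suc i)) \<in> rel M \<beta> \<longleftrightarrow> \<gamma>s ! i = \<beta>))"

definition valid_over :: "'w itself \<Rightarrow> ('n, 'p) fm \<Rightarrow> bool" where
  "valid_over _ \<phi> \<longleftrightarrow>
     (\<forall>M :: ('w, 'n, 'p) model. is_model M \<longrightarrow> (\<forall>w\<in>worlds M. sat M w \<phi>))"

text \<open>
  HOL cannot quantify over the type of worlds inside a formula. Models with worlds in \<open>nat\<close>
  suffice: by the downward Loewenheim-Skolem argument below (\<open>valid_iff_valid_over\<close>,
  \<open>valid_imp_valid_over\<close>) validity over them amounts to validity over models of any type.
\<close>

definition valid :: "('n, 'p) fm \<Rightarrow> bool"  (\<open>\<tturnstile> _\<close> [50] 50) where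
  "\<tturnstile> \<phi> \<longleftrightarrow> valid_over TYPE(nat) \<phi>"

definition submodel :: "('w, 'n, 'p) model \<Rightarrow> 'w set \<Rightarrow> ('w, 'n, 'p) model" where
  "submodel M U = \<lparr>worlds = U, rel_run = (\<lambda>\<alpha>. rel_run M \<alpha> \<inter> U \<times> U),
     rel_end = rel_end M \<inter> U \<times> U, val = (\<lambda>p. val M p \<inter> U)\<rparr>"

definition image_model :: "('w \<Rightarrow> 'v) \<Rightarrow> ('w, 'n, 'p) model \<Rightarrow> ('v, 'n, 'p) model" where
  "image_model f M = \<lparr>worlds = f ` worlds M, rel_run = (\<lambda>\<alpha>. map_prod f f ` rel_run M \<alpha>),
     rel_end = map_prod f f ` rel_end M, val = (\<lambda>p. f ` val M p)\<rparr>"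

lemma rel_submodel: "rel (submodel M U) \<beta> = rel M \<beta> \<inter> U \<times> U"
  by (cases \<beta>) (auto simp: submodel_def)

lemma rel_image_model: "rel (image_model f M) \<beta> = map_prod f f ` rel M \<beta>"
  by (cases \<beta>) (auto simp: image_model_def)

lemma rel_subset: "is_model M \<Longrightarrow> rel M \<beta> \<subseteq> worlds M \<times> worlds M"
  by (cases \<beta>) (auto simp: is_model_def)

lemma is_model_submodel: "is_model M \<Longrightarrow> U \<subseteq> worlds M \<Longrightarrow> U \<noteq> {} \<Longrightarrow> is_model (submodel M U)"
  by (auto simp: is_model_def submodel_def)

lemma is_model_image_model: "is_model M \<Longrightarrow> is_model (image_model f M)"
  unfolding is_model_def image_model_def by (fastforce simp: Id_on_def)

lemma sat_submodel:
  fixes M :: "('w, 'n, 'p) model"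
  assumes M: "is_model M"
  shows "\<exists>C. (\<forall>u. countable (C u) \<and> C u \<subseteq> worlds M) \<and>
     (\<forall>U\<subseteq>worlds M. (\<forall>u\<in>U. C u \<subseteq> U) \<longrightarrow> (\<forall>u\<in>U. sat (submodel M U) u \<phi> = sat M u \<phi>))"
proof (induction \<phi>)
  case (Atom p)
  then show ?case by (intro exI[of _ "\<lambda>_. {}"]) (auto simp: submodel_def)
next
  case Top
  then show ?case by (intro exI[of _ "\<lambda>_. {}"]) auto
next
  case (Neg \<phi>)
  then show ?case unfolding sat.simps by metis
next
  case (Conj \<phi> \<psi>)
  obtain C where
    C: "\<forall>u. countable (C u) \<and> C u \<subseteq> worlds M"
      "\<forall>U\<subseteq>worlds M. (\<forall>u\<in>U. C u \<subseteq> U) \<longrightarrow> (\<forall>u\<in>U. sat (submodel M U) u \<phi> = sat M u \<phi>)"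
    using Conj.IH(1) by (elim exE conjE) (rule that)
  obtain D where
    D: "\<forall>u. countable (D u) \<and> D u \<subseteq> worlds M"
      "\<forall>U\<subseteq>worlds M. (\<forall>u\<in>U. D u \<subseteq> U) \<longrightarrow> (\<forall>u\<in>U. sat (submodel M U) u \<psi> = sat M u \<psi>)"
    using Conj.IH(2) by (elim exE conjE) (rule that)
  have "sat (submodel M U) u (Conj \<phi> \<psi>) = sat M u (Conj \<phi> \<psi>)"
    if U: "U \<subseteq> worlds M" "\<forall>u\<in>U. C u \<union> D u \<subseteq> U" "u \<in> U" for U u
  proof -
    have "\<forall>u\<in>U. C u \<subseteq> U" "\<forall>u\<in>U. D u \<subseteq> U" using U(2) by auto
    then show ?thesis using C(2) D(2) U(1,3) unfolding sat.simps by blast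
  qed
  moreover have "countable (C u \<union> D u) \<and> C u \<union> D u \<subseteq> worlds M" for u
    using C(1) D(1) by (meson Un_least countable_Un)
  ultimately show ?case by (intro exI[of _ "\<lambda>u. C u \<union> D u"] conjI allI impI ballI) blast+
next
  case (DiaA \<alpha> \<phi>)
  obtain C where
    C: "\<forall>u. countable (C u) \<and> C u \<subseteq> worlds M"
      "\<forall>U\<subseteq>worlds M. (\<forall>u\<in>U. C u \<subseteq> U) \<longrightarrow> (\<forall>u\<in>U. sat (submodel M U) u \<phi> = sat M u \<phi>)"
    using DiaA.IH by (elim exE conjE) (rule that)
  have "\<exists>v. sat M u (DiaA \<alpha> \<phi>) \<longrightarrow> (u, v) \<in> rel_run M \<alpha> \<and> sat M v \<phi>" for u by auto
  then obtain g where g: "\<And>u. sat M u (DiaA \<alpha> \<phi>) \<Longrightarrow> (u, g u) \<in> rel_run M \<alpha> \<and> sat M (g u) \<phi>"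
    by metis
  define D where "D u = C u \<union> (if sat M u (DiaA \<alpha> \<phi>) then {g u} else {})" for u
  have 1: "countable (D u) \<and> D u \<subseteq> worlds M" for u
    using C(1) g[of u] rel_subset[OF M, of "Run \<alpha>"] unfolding D_def by auto
  have 2: "sat (submodel M U) u (DiaA \<alpha> \<phi>) = sat M u (DiaA \<alpha> \<phi>)"
    if U: "U \<subseteq> worlds M" "\<forall>u\<in>U. D u \<subseteq> U" "u \<in> U" for U u
  proof -
    have eq: "sat (submodel M U) v \<phi> = sat M v \<phi>" if "v \<in> U" for v
      using C(2) U that unfolding D_def by blast
    show ?thesis
    proof
      assume "sat (submodel M U) u (DiaA \<alpha> \<phi>)"
      then show "sat M u (DiaA \<alpha> \<phi>)" using eq by (auto simp: submodel_def)
    next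
      assume s: "sat M u (DiaA \<alpha> \<phi>)"
      have "g u \<in> U" using U s unfolding D_def by fastforce
      then show "sat (submodel M U) u (DiaA \<alpha> \<phi>)"
        using g[OF s] eq U(3) by (auto simp: submodel_def)
    qed
  qed
  show ?case using 1 2 by (intro exI[of _ D] conjI allI impI ballI) blast+
next
  case (DiaP P \<phi>)
  obtain C where
    C: "\<forall>u. countable (C u) \<and> C u \<subseteq> worlds M"
      "\<forall>U\<subseteq>worlds M. (\<forall>u\<in>U. C u \<subseteq> U) \<longrightarrow> (\<forall>u\<in>U. sat (submodel M U) u \<phi> = sat M u \<phi>)"
    using DiaP.IH by (elim exE conjE) (rule that)
  let ?W = "\<lambda>N u v n \<gamma>s. n \<ge> 1 \<and> (\<forall>i\<le>n. v i \<in> worlds N) \<and> v 0 = u \<and> sat N (v n) \<phi> \<and>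
        \<gamma>s \<in> Rf P \<and> length \<gamma>s = n \<and>
        (\<forall>i<n. \<forall>\<beta>. (v i, v (Suc i)) \<in> rel N \<beta> \<longleftrightarrow> \<gamma>s ! i = \<beta>)"
  have "\<forall>u. \<exists>v n \<gamma>s. sat M u (DiaP P \<phi>) \<longrightarrow> ?W M u v n \<gamma>s" by simp
  then obtain v n \<gamma>s where g: "\<And>u. sat M u (DiaP P \<phi>) \<Longrightarrow> ?W M u (v u) (n u) (\<gamma>s u)"
    by metis
  define D where "D u = C u \<union> (if sat M u (DiaP P \<phi>) then v u ` {..n u} else {})" for u
  have 1: "countable (D u) \<and> D u \<subseteq> worlds M" for u
  proof (cases "sat M u (DiaP P \<phi>)")
    case True
    have "v u ` {..n u} \<subseteq> worlds M" using g[OF True] by blast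
    then show ?thesis using C(1) True by (simp add: D_def)
  next
    case False
    then show ?thesis using C(1) by (simp only: D_def if_False Un_empty_right simp_thms)
  qed
  have 2: "sat (submodel M U) u (DiaP P \<phi>) = sat M u (DiaP P \<phi>)"
    if U: "U \<subseteq> worlds M" "\<forall>u\<in>U. D u \<subseteq> U" "u \<in> U" for U u
  proof -
    have eq: "sat (submodel M U) v \<phi> = sat M v \<phi>" if "v \<in> U" for v
      using C(2) U that unfolding D_def by blast
    have W: "worlds (submodel M U) = U" by (simp add: submodel_def)
    show ?thesis
    proof
      assume "sat (submodel M U) u (DiaP P \<phi>)"
      then obtain v n \<gamma>s where w: "?W (submodel M U) u v n \<gamma>s" unfolding sat.simps by blast
      have vU: "\<forall>i\<le>n. v i \<in> U" using w unfolding W by blast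
      have "(v i, v (Suc i)) \<in> rel (submodel M U) \<beta> \<longleftrightarrow> (v i, v (Suc i)) \<in> rel M \<beta>" if "i < n" for i \<beta>
        using vU that unfolding rel_submodel by auto
      moreover have "sat M (v n) \<phi>" using w vU eq by blast
      ultimately have "?W M u v n \<gamma>s" using w vU U(1) by blast
      then show "sat M u (DiaP P \<phi>)" unfolding sat.simps by blast
    next
      assume s: "sat M u (DiaP P \<phi>)"
      have "v u ` {..n u} \<subseteq> D u" using s by (simp only: D_def if_True Un_upper2)
      then have vU: "\<forall>i\<le>n u. v u i \<in> U" using U(2,3) by blast
      have "(v u i, v u (Suc i)) \<in> rel (submodel M U) \<beta> \<longleftrightarrow> (v u i, v u (Suc i)) \<in> rel M \<beta>"
        if "i < n u" for i \<beta>
        using vU that unfolding rel_submodel by auto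
      moreover have "sat (submodel M U) (v u (n u)) \<phi>" using g[OF s] vU eq by blast
      ultimately have "?W (submodel M U) u (v u) (n u) (\<gamma>s u)" using g[OF s] vU W by blast
      then show "sat (submodel M U) u (DiaP P \<phi>)" unfolding sat.simps by blast
    qed
  qed
  show ?case using 1 2 by (intro exI[of _ D] conjI allI impI ballI) blast+
qed

lemma sat_image_model:
  fixes M :: "('w, 'n, 'p) model" and f :: "'w \<Rightarrow> 'v"
  assumes M: "is_model M" and f: "inj_on f (worlds M)" and u: "u \<in> worlds M"
  shows "sat (image_model f M) (f u) \<phi> = sat M u \<phi>"
  using u
proof (induction \<phi> arbitrary: u)
  case (Atom p)
  have "val M p \<subseteq> worlds M" using M by (simp add: is_model_def)
  then show ?case using f Atom by (auto simp: image_model_def dest: inj_onD)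
next
  case (DiaA \<alpha> \<phi>)
  have sub: "rel_run M \<alpha> \<subseteq> worlds M \<times> worlds M" using M by (simp add: is_model_def)
  have r: "rel_run (image_model f M) \<alpha> = map_prod f f ` rel_run M \<alpha>" by (simp add: image_model_def)
  show ?case
  proof
    assume "sat (image_model f M) (f u) (DiaA \<alpha> \<phi>)"
    then obtain a b where ab: "(a, b) \<in> rel_run M \<alpha>" "f u = f a" "sat (image_model f M) (f b) \<phi>"
      by (auto simp: r)
    then have "a = u" "b \<in> worlds M" using sub f DiaA.prems by (auto dest: inj_onD)
    then show "sat M u (DiaA \<alpha> \<phi>)" using ab DiaA.IH by auto
  next
    assume "sat M u (DiaA \<alpha> \<phi>)"
    then obtain b where b: "(u, b) \<in> rel_run M \<alpha>" "sat M b \<phi>" by auto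
    then have "sat (image_model f M) (f b) \<phi>" using DiaA.IH sub by blast
    moreover have "(f u, f b) \<in> rel_run (image_model f M) \<alpha>" using b by (force simp: r)
    ultimately show "sat (image_model f M) (f u) (DiaA \<alpha> \<phi>)" by auto
  qed
next
  case (DiaP P \<phi>)
  let ?N = "image_model f M"
  have W: "worlds ?N = f ` worlds M" by (simp add: image_model_def)
  have r: "(f a, f b) \<in> rel ?N \<beta> \<longleftrightarrow> (a, b) \<in> rel M \<beta>"
    if "a \<in> worlds M" "b \<in> worlds M" for a b \<beta>
  proof
    assume "(f a, f b) \<in> rel ?N \<beta>"
    then obtain c d where cd: "(c, d) \<in> rel M \<beta>" "f a = f c" "f b = f d"
      unfolding rel_image_model by auto
    then have "c \<in> worlds M" "d \<in> worlds M" using rel_subset[OF M, of \<beta>] by auto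
    then have "a = c" "b = d" using cd that f by (auto dest: inj_onD)
    then show "(a, b) \<in> rel M \<beta>" using cd by simp
  next
    assume "(a, b) \<in> rel M \<beta>"
    then show "(f a, f b) \<in> rel ?N \<beta>"
      unfolding rel_image_model by (metis image_eqI map_prod_simp)
  qed
  let ?W = "\<lambda>v n \<gamma>s. \<gamma>s \<in> Rf P \<and> length \<gamma>s = n \<and>
        (\<forall>i<n. \<forall>\<beta>. (v i, v (Suc i)) \<in> rel M \<beta> \<longleftrightarrow> \<gamma>s ! i = \<beta>)"
  let ?V = "\<lambda>v n \<gamma>s. \<gamma>s \<in> Rf P \<and> length \<gamma>s = n \<and>
        (\<forall>i<n. \<forall>\<beta>. (v i, v (Suc i)) \<in> rel ?N \<beta> \<longleftrightarrow> \<gamma>s ! i = \<beta>)"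
  show ?case
  proof
    assume "sat ?N (f u) (DiaP P \<phi>)"
    then obtain v n \<gamma>s where v: "n \<ge> 1" "\<forall>i\<le>n. v i \<in> f ` worlds M" "v 0 = f u" "sat ?N (v n) \<phi>"
      "?V v n \<gamma>s" unfolding sat.simps W by blast
    define x where "x i = inv_into (worlds M) f (v i)" for i
    have x: "x i \<in> worlds M" "f (x i) = v i" if "i \<le> n" for i
      using v(2) that unfolding x_def by (auto intro: inv_into_into f_inv_into_f)
    have "x 0 = u" using x[of 0] v(3) f DiaP.prems by (auto dest: inj_onD)
    moreover have "sat M (x n) \<phi>" using v(4) x[of n] DiaP.IH by (metis order_refl)
    moreover have "?W x n \<gamma>s" using v(5) x r by (metis Suc_leI less_imp_le_nat)
    ultimately show "sat M u (DiaP P \<phi>)" using x(1) v(1) unfolding sat.simps by blast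
  next
    assume "sat M u (DiaP P \<phi>)"
    then obtain v n \<gamma>s where v: "n \<ge> 1" "\<forall>i\<le>n. v i \<in> worlds M" "v 0 = u" "sat M (v n) \<phi>"
      "?W v n \<gamma>s" unfolding sat.simps by blast
    have "sat ?N (f (v n)) \<phi>" using v(2,4) DiaP.IH by blast
    moreover have "?V (\<lambda>i. f (v i)) n \<gamma>s" using v(2,5) r by (metis Suc_leI less_imp_le_nat)
    ultimately have "\<exists>n \<gamma>s. n \<ge> 1 \<and> (\<forall>i\<le>n. f (v i) \<in> worlds ?N) \<and> f (v 0) = f u \<and>
        sat ?N (f (v n)) \<phi> \<and> ?V (\<lambda>i. f (v i)) n \<gamma>s"
      using v(1,2,3) unfolding W by blast
    then show "sat ?N (f u) (DiaP P \<phi>)" unfolding sat.simps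
      by (intro exI[of _ "\<lambda>i. f (v i)"]) blast
  qed
qed auto

theorem valid_imp_valid_over:
  fixes \<phi> :: "('n, 'p) fm"
  assumes "\<tturnstile> \<phi>"
  shows "valid_over TYPE('w) \<phi>"
  unfolding valid_over_def
proof (intro allI impI ballI)
  fix M :: "('w, 'n, 'p) model" and w
  assume M: "is_model M" and w: "w \<in> worlds M"
  obtain C where C: "\<And>u. countable (C u)" "\<And>u. C u \<subseteq> worlds M"
    "\<And>U u. U \<subseteq> worlds M \<Longrightarrow> \<forall>u\<in>U. C u \<subseteq> U \<Longrightarrow> u \<in> U \<Longrightarrow> sat (submodel M U) u \<phi> = sat M u \<phi>"
    using sat_submodel[OF M, of \<phi>] by metis
  define S where "S = {(u, v). v \<in> C u}"
  define U where "U = S\<^sup>* `` {w}"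
  have "countable (S `` Y)" if "countable Y" for Y
  proof -
    have "S `` Y = (\<Union>u\<in>Y. C u)" unfolding S_def by auto
    then show ?thesis using that C(1) by simp
  qed
  then have cU: "countable U" unfolding U_def by (intro countable_rtrancl) auto
  have wU: "w \<in> U" unfolding U_def by simp
  have UW: "U \<subseteq> worlds M"
  proof
    fix x assume "x \<in> U"
    then have "(w, x) \<in> S\<^sup>*" unfolding U_def by simp
    then show "x \<in> worlds M"
      by (induction rule: rtrancl_induct) (use w C(2) in \<open>auto simp: S_def\<close>)
  qed
  have clU: "\<forall>u\<in>U. C u \<subseteq> U" unfolding U_def S_def by (auto intro: rtrancl_into_rtrancl)
  let ?S = "submodel M U"
  have mS: "is_model ?S" using M UW wU by (intro is_model_submodel) auto
  have WS: "worlds ?S = U" by (simp add: submodel_def)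
  have inj: "inj_on (to_nat_on U) (worlds ?S)" using cU WS by (simp add: inj_on_to_nat_on)
  have "sat (image_model (to_nat_on U) ?S) (to_nat_on U w) \<phi>"
    using assms is_model_image_model[OF mS, of "to_nat_on U"] wU
    unfolding valid_def valid_over_def by (auto simp: image_model_def WS)
  then have "sat ?S w \<phi>" using sat_image_model[OF mS inj] wU WS by metis
  then show "sat M w \<phi>" using C(3)[OF UW clU wU] by simp
qed

theorem valid_iff_valid_over:
  fixes \<phi> :: "('n, 'p) fm"
  assumes "infinite (UNIV :: 'w set)"
  shows "\<tturnstile> \<phi> \<longleftrightarrow> valid_over TYPE('w) \<phi>"
proof
  assume v: "valid_over TYPE('w) \<phi>"
  obtain f :: "nat \<Rightarrow> 'w" where f: "inj f"
    using assms infinite_countable_subset by blast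
  show "\<tturnstile> \<phi>" unfolding valid_def valid_over_def
  proof (intro allI impI ballI)
    fix M :: "(nat, 'n, 'p) model" and w
    assume M: "is_model M" and w: "w \<in> worlds M"
    have "sat (image_model f M) (f w) \<phi>"
      using v is_model_image_model[OF M, of f] w
      unfolding valid_over_def by (auto simp: image_model_def)
    then show "sat M w \<phi>" using sat_image_model[OF M inj_on_subset[OF f] w] by simp
  qed
qed (rule valid_imp_valid_over)

end

theory Submission
  imports Defs
begin

text \<open>
  The formula \<open>\<langle>P\<rangle>p\<close> determines the set of successful runs of \<open>P\<close>: in the model that is a chain
  spelling out a single run, with \<open>p\<close> true only at its last world, \<open>\<langle>P\<rangle>p\<close> holds at the first world
  iff that run is a run of \<open>P\<close>. On the other hand, the successful runs of \<open>P \<parallel> R\<close> are the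
  synchronising interleavings of runs of \<open>P\<close> with runs of \<open>R\<close>, so they depend on \<open>P\<close> only
  through its set of runs.
\<close>

text \<open>Only \<open>End\<close> leads to \<open>Done\<close>; this and the converse fact for
  \<open>End\<close> let \<open>Rf\<close> be unfolded one action at a time.\<close>

lemma step_Run_target:
  assumes "step P (Run \<alpha>) X"
  obtains P' where "X = Proc P'"
proof -
  have "\<exists>P'. X = Proc P'" if "step P \<gamma> X" "\<gamma> = Run \<alpha>" for \<gamma>
    using that by (induction rule: step.induct) auto
  then show thesis using assms that by blast
qed

lemma step_End_target:
  fixes P :: "'n proc"
  shows "step P End X \<Longrightarrow> X = Done"
  by (induction P "End :: 'n action" X rule: step.induct) auto

lemma steps_Done_iff [simp]: "steps Done \<gamma>s X \<longleftrightarrow> \<gamma>s = [] \<and> X = Done"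
  by (auto elim: steps.cases intro: steps.intros)

lemma Rf_Nil [simp]: "[] \<notin> Rf P"
  by (auto simp: Rf_def elim: steps.cases)

lemma Rf_Run_Cons: "Run \<alpha> # \<gamma>s \<in> Rf P \<longleftrightarrow> (\<exists>P'. step P (Run \<alpha>) (Proc P') \<and> \<gamma>s \<in> Rf P')"
  unfolding Rf_def
  by (auto elim!: steps.cases[of "Proc P"] elim: step_Run_target intro: steps_Cons)

lemma Rf_End_Cons: "End # \<gamma>s \<in> Rf P \<longleftrightarrow> step P End Done \<and> \<gamma>s = []"
  unfolding Rf_def
  by (auto elim!: steps.cases[of "Proc P"] dest: step_End_target intro!: steps_Cons)

text \<open>No transition leaves \<open>Done\<close>, and \<open>End\<close> always leads there, so
  \<open>End\<close> can only close a run; the empty list is no run because a process differs from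
  \<open>Done\<close>.\<close>

lemma Rf_shape:
  assumes "\<gamma>s \<in> Rf P"
  obtains as where "\<gamma>s = map Run as @ [End]"
proof -
  have "\<exists>as. \<gamma>s = map Run as @ [End]"
    using assms
  proof (induction \<gamma>s arbitrary: P)
    case (Cons \<gamma> \<gamma>s)
    show ?case
    proof (cases \<gamma>)
      case (Run \<alpha>)
      then obtain as where "\<gamma>s = map Run as @ [End]"
        using Cons by (auto simp: Rf_Run_Cons)
      then have "\<gamma> # \<gamma>s = map Run (\<alpha> # as) @ [End]" using Run by simp
      then show ?thesis by blast
    next
      case End
      then have "\<gamma> # \<gamma>s = map Run [] @ [End]" using Cons.prems by (simp add: Rf_End_Cons)
      then show ?thesis by blast
    qed
  qed simp
  then show thesis using that by blast
qed

text \<open>If \<open>as\<close> and \<open>bs\<close> are runs read as processes, the lists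
  \<open>cs\<close> are the runs of their parallel composition. Working on lists avoids turning runs
  into process terms.\<close>

inductive merge :: "'n action list \<Rightarrow> 'n action list \<Rightarrow> 'n action list \<Rightarrow> bool" where
  merge_End: "merge [End] [End] [End]"
| merge_L: "merge as bs cs \<Longrightarrow> merge (Run \<alpha> # as) bs (Run \<alpha> # cs)"
| merge_R: "merge as bs cs \<Longrightarrow> merge as (Run \<alpha> # bs) (Run \<alpha> # cs)"
| merge_sync: "merge as bs cs
    \<Longrightarrow> merge (Run (Lab l) # as) (Run (Lab (co l)) # bs) (Run Tau # cs)"

text \<open>The rules for a transition of \<open>P \<parallel> R\<close> match those of
  \<open>merge\<close> one by one. Both processes vary in the induction, since a transition may
  change either.\<close>

lemma Rf_Par_imp_merge:
  "cs \<in> Rf (P \<parallel> R) \<Longrightarrow> \<exists>as\<in>Rf P. \<exists>bs\<in>Rf R. merge as bs cs"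
proof (induction cs arbitrary: P R)
  case (Cons \<gamma> cs)
  show ?case
  proof (cases \<gamma>)
    case (Run \<alpha>)
    then obtain S where S: "step (P \<parallel> R) (Run \<alpha>) (Proc S)" "cs \<in> Rf S"
      using Cons.prems by (auto simp: Rf_Run_Cons)
    from S(1) show ?thesis
    proof cases
      case (step_ParL P')
      then obtain as bs where "as \<in> Rf P'" "bs \<in> Rf R" "merge as bs cs"
        using Cons.IH S(2) by blast
      then show ?thesis using step_ParL Run by (meson Rf_Run_Cons merge_L)
    next
      case (step_ParR R')
      then obtain as bs where "as \<in> Rf P" "bs \<in> Rf R'" "merge as bs cs"
        using Cons.IH S(2) by blast
      then show ?thesis using step_ParR Run by (meson Rf_Run_Cons merge_R)
    next
      case (step_Par_sync l P' R')
      then obtain as bs where "as \<in> Rf P'" "bs \<in> Rf R'" "merge as bs cs"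
        using Cons.IH S(2) by blast
      then show ?thesis using step_Par_sync Run by (metis Rf_Run_Cons merge_sync)
    qed
  next
    case End
    then have "step (P \<parallel> R) End Done" "cs = []"
      using Cons.prems by (auto simp: Rf_End_Cons)
    from this(1) have "step P End Done" "step R End Done" by (auto elim: step.cases)
    then show ?thesis using \<open>cs = []\<close> End Rf_End_Cons merge_End by metis
  qed
qed simp

lemma merge_imp_Rf_Par:
  "merge as bs cs \<Longrightarrow> as \<in> Rf P \<Longrightarrow> bs \<in> Rf R \<Longrightarrow> cs \<in> Rf (P \<parallel> R)"
proof (induction arbitrary: P R rule: merge.induct)
  case merge_End
  then show ?case by (auto simp: Rf_End_Cons intro: step_Par_end)
next
  case (merge_L as bs cs \<alpha>)
  then show ?case by (meson Rf_Run_Cons step_ParL)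
next
  case (merge_R as bs cs \<alpha>)
  then show ?case by (meson Rf_Run_Cons step_ParR)
next
  case (merge_sync as bs cs l)
  then show ?case by (meson Rf_Run_Cons step_Par_sync)
qed

lemma Rf_Par: "Rf (P \<parallel> R) = {cs. \<exists>as\<in>Rf P. \<exists>bs\<in>Rf R. merge as bs cs}"
  using Rf_Par_imp_merge merge_imp_Rf_Par by blast

text \<open>Only running actions need edges: the closing \<open>End\<close> of the run is the
  identity loop at the last world.\<close>

definition chain_model :: "'n running list \<Rightarrow> (nat, 'n, 'p) model" where
  "chain_model as = \<lparr>worlds = {..length as},
     rel_run = (\<lambda>\<alpha>. {(i, Suc i) |i. i < length as \<and> as ! i = \<alpha>}),
     rel_end = Id_on {..length as}, val = (\<lambda>_. {length as})\<rparr>"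

lemma is_model_chain_model: "is_model (chain_model as)"
  by (auto simp: is_model_def chain_model_def)

lemma rel_run_chain_model:
  "(i, j) \<in> rel_run (chain_model as) \<alpha> \<longleftrightarrow> j = Suc i \<and> i < length as \<and> as ! i = \<alpha>"
  by (auto simp: chain_model_def)

lemma rel_end_chain_model:
  "(i, j) \<in> rel_end (chain_model as) \<longleftrightarrow> j = i \<and> i \<le> length as"
  by (auto simp: chain_model_def)

lemma sat_chain_model_iff:
  fixes p :: 'p
  defines "M \<equiv> \<lambda>as. chain_model as :: (nat, 'n, 'p) model"
  shows "sat (M as) 0 (DiaP P (Atom p)) \<longleftrightarrow> map Run as @ [End] \<in> Rf P"
proof
  assume run: "map Run as @ [End] \<in> Rf P"
  define k where "k = length as"
  \<comment> \<open>The path has one edge more than the chain; \<open>min\<close> makes it stay at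
    \<open>k\<close> for the final \<open>End\<close>. Each edge used carries a single label, as the
    equivalence in \<open>sat\<close> demands.\<close>
  have "(min i k, min (Suc i) k) \<in> rel (M as) \<beta> \<longleftrightarrow> (map Run as @ [End]) ! i = \<beta>"
    if "i < Suc k" for i \<beta>
    using that unfolding M_def k_def
    by (cases \<beta>; cases "i < length as")
      (auto simp: rel_run_chain_model rel_end_chain_model nth_append less_Suc_eq)
  then show "sat (M as) 0 (DiaP P (Atom p))"
    unfolding sat.simps using run
    by (intro exI[of _ "\<lambda>i. min i k"] exI[of _ "Suc k"] exI[of _ "map Run as @ [End]"])
      (simp add: k_def M_def chain_model_def)
next
  assume "sat (M as) 0 (DiaP P (Atom p))"
  then obtain v \<gamma>s where v: "v 0 = 0" "v (length \<gamma>s) = length as" and \<gamma>s: "\<gamma>s \<in> Rf P"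
    and r: "\<And>i. i < length \<gamma>s \<Longrightarrow> (v i, v (Suc i)) \<in> rel (M as) (\<gamma>s ! i)"
    by (auto simp: M_def chain_model_def)
  obtain bs where bs: "\<gamma>s = map Run bs @ [End]" using \<gamma>s by (rule Rf_shape)
  have r_run: "(v i, v (Suc i)) \<in> rel_run (M as) (bs ! i)" if "i < length bs" for i
    using r[of i] that by (simp add: bs nth_append)
  have r_end: "(v (length bs), v (Suc (length bs))) \<in> rel_end (M as)"
    using r[of "length bs"] by (simp add: bs nth_append)
  \<comment> \<open>Every world has an \<open>End\<close> loop, but \<open>bs\<close> holds running
    actions only, so each of these edges moves to the successor.\<close>
  have id: "v i = i" if "i \<le> length bs" for i
    using that
  proof (induction i)
    case (Suc i)
    then show ?case using r_run[of i] by (simp add: M_def rel_run_chain_model)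
  qed (simp add: v)
  \<comment> \<open>The closing \<open>End\<close> does not move, so the world reached after
    \<open>bs\<close> is already the one where the atom holds.\<close>
  have "length bs = length as"
    using r_end v(2) id[of "length bs"] by (simp add: M_def rel_end_chain_model bs)
  moreover have "as ! i = bs ! i" if "i < length bs" for i
    using r_run[OF that] id[of i] that by (simp add: M_def rel_run_chain_model)
  ultimately have "bs = as" by (simp add: nth_equalityI)
  then show "map Run as @ [End] \<in> Rf P" using \<gamma>s bs by simp
qed

lemma sat_Iff [simp]: "sat M w (Iff \<phi> \<psi>) \<longleftrightarrow> (sat M w \<phi> \<longleftrightarrow> sat M w \<psi>)"
  by (auto simp: Iff_def)

text \<open>Chains have natural numbers as worlds, so they are among the models that
  \<open>valid\<close> ranges over. Conversely, \<open>sat\<close> reads a process only through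
  \<open>Rf\<close>.\<close>

lemma valid_Iff_DiaP_iff:
  fixes P Q :: "'n proc" and p :: 'p
  shows "\<tturnstile> Iff (DiaP P (Atom p)) (DiaP Q (Atom p)) \<longleftrightarrow> Rf P = Rf Q"
proof
  assume valid: "\<tturnstile> Iff (DiaP P (Atom p)) (DiaP Q (Atom p))"
  have "map Run as @ [End] \<in> Rf P \<longleftrightarrow> map Run as @ [End] \<in> Rf Q" for as
  proof -
    let ?M = "chain_model as :: (nat, 'n, 'p) model"
    have "0 \<in> worlds ?M" by (simp add: chain_model_def)
    then have "sat ?M 0 (Iff (DiaP P (Atom p)) (DiaP Q (Atom p)))"
      using valid is_model_chain_model unfolding valid_def valid_over_def by blast
    then show ?thesis by (simp only: sat_Iff sat_chain_model_iff)
  qed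
  then show "Rf P = Rf Q" by (metis Rf_shape subsetI subset_antisym)
qed (simp add: valid_def valid_over_def)

theorem theorem5p15:
  fixes P Q R :: "'n proc" and p :: 'p
  assumes "\<tturnstile> Iff (DiaP P (Atom p)) (DiaP Q (Atom p))"
  shows "\<tturnstile> Iff (DiaP (P \<parallel> R) (Atom p)) (DiaP (Q \<parallel> R) (Atom p))"
  using assms by (simp add: valid_Iff_DiaP_iff Rf_Par)

end
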